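(* Let $X=C_{2\pi}(\mathbb R,\mathbb C)$ be the space of all $2\pi$-periodic continuous functions $\mathbb R\to\mathbb C$ with norm $\|x\|_X=\max_{s\in\mathbb R}|x(s)|$, and let $Y=\mathbb C$. Let $A$ be the generator of the left translation group $T(\cdot)$ on $X$, $(T(t)x)(s)=x(s+t)$, $s,t\in\mathbb R$, and let $C:X\to\mathbb C$, $Cx=x(0)$. Consider the system $\dot x(t)=Ax(t)$, $y(t)=Cx(t)$. Then: (i) The system admits a coercive eOSS Lyapunov function in implication form with linear Lyapunov gain and $p=1$. (ii) The system is eOSS with linear gain. (iii) For any given $\rho\in\mathcal P$ and $\sigma\in\mathcal K_\infty$, the system does not admit a function $V:X\to\mathbb R_+$ which is continuous along the trajectories (i.e. for every $x\in X$ the map $t\mapsto V(T(t)x)$, $t\ge0$, is continuous) and satisfies the dissipation inequality $$\dot V(x)\le-\rho(\|x\|_X)+\sigma(\|Cx\|_Y),\quad x\in X.$$ (iv) There is no coercive eOSS Lyapunov function in dissipation form for the system.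
   Context: $\mathbb R_+=[0,\infty)$. $\mathcal P$ is the set of continuous $\gamma:\mathbb R_+\to\mathbb R_+$ with $\gamma(0)=0$ and $\gamma(r)>0$ for $r>0$; $\mathcal K$ is the set of strictly increasing $\gamma\in\mathcal P$; $\mathcal K_\infty$ is the set of unbounded $\gamma\in\mathcal K$. The mild solution with initial state $x\in X$ is $\phi(t,x)=T(t)x$ and the output trajectory is $y(t,x)=CT(t)x$, $t\ge0$. Lie derivative: $\dot V(x):=\limsup_{\tau\to+0}\frac{V(\phi(\tau,x))-V(x)}{\tau}$ (limsup in the extended real line), provided $t\mapsto V(\phi(t,x))$ is continuous at $t=0$. $V:X\to\mathbb R_+$ is a coercive eOSS Lyapunov function in dissipation form if: (a) there exist $k_1,k_2,p>0$ with $k_1\|x\|_X^p\le V(x)\le k_2\|x\|_X^p$ for all $x\in X$; (b) for every $x\in X$ the map $t\mapsto V(\phi(t,x))$, $t\ge0$, is continuous; (c) there exist $\alpha>0$ and $\sigma\in\mathcal K_\infty$ such that, with $p$ as in (a), $\dot V(x)\le-\alpha\|x\|_X^p+\sigma(\|Cx\|_Y)$ for all $x\in X$. It is a coercive eOSS Lyapunov function in implication form if (a), (b) hold and (c) is replaced by: (c') there exist $\tilde\alpha>0$ and $\chi\in\mathcal K_\infty$ such that, with $p$ as in (a), for every $x\in X$: $\|x\|_X\ge\chi(\|Cx\|_Y)\Rightarrow\dot V(x)\le-\tilde\alpha\|x\|_X^p$; it has linear Lyapunov gain if $\chi$ can be chosen linear. eOSS with linear gain: there exist $M,\mu>0$ and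 a linear $\gamma\in\mathcal K$ such that for all $x\in X$, $t\ge0$: $\|\phi(t,x)\|_X\le Me^{-\mu t}\|x\|_X+\gamma\bigl(\max_{s\in[0,t]}\|y(s,x)\|_Y\bigr)$. *)

theory Defs
  imports "HOL-Analysis.Analysis" "HOL-Library.Periodic_Fun"
begin

section \<open>Comparison functions\<close>

text \<open>Functions on \<open>[0,\<infinity>)\<close> are represented by functions of type \<open>real \<Rightarrow> real\<close> of which only the
  values on \<open>{0..}\<close> matter.\<close>

definition class_P :: "(real \<Rightarrow> real) set" where
  "class_P = {\<gamma>. continuous_on {0..} \<gamma> \<and> \<gamma> 0 = 0 \<and> (\<forall>r>0. \<gamma> r > 0)}"

definition class_K :: "(real \<Rightarrow> real) set" where
  "class_K = {\<gamma> \<in> class_P. strict_mono_on {0..} \<gamma>}"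

definition class_K_inf :: "(real \<Rightarrow> real) set" where
  "class_K_inf = {\<gamma> \<in> class_K. \<not> bdd_above (\<gamma> ` {0..})}"

definition linear_gain :: "(real \<Rightarrow> real) \<Rightarrow> bool" where
  "linear_gain \<gamma> \<longleftrightarrow> (\<exists>c. \<forall>r\<ge>0. \<gamma> r = c * r)"

section \<open>Linear systems with output\<close>

text \<open>An unbounded operator is given by its graph.\<close>

definition c0_semigroup :: "(real \<Rightarrow> 'x::real_normed_vector \<Rightarrow> 'x) \<Rightarrow> bool" where
  "c0_semigroup T \<longleftrightarrow>
     (\<forall>t\<ge>0. bounded_linear (T t)) \<and> (\<forall>x. T 0 x = x) \<and>
     (\<forall>s\<ge>0. \<forall>t\<ge>0. \<forall>x. T (s + t) x = T s (T t x)) \<and>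
     (\<forall>x. ((\<lambda>t. T t x) \<longlongrightarrow> x) (at_right 0))"

definition generator :: "(real \<Rightarrow> 'x::real_normed_vector \<Rightarrow> 'x) \<Rightarrow> ('x \<times> 'x) set" where
  "generator T = {(x, z). ((\<lambda>h. (T h x - x) /\<^sub>R h) \<longlongrightarrow> z) (at_right 0)}"

text \<open>The system \<open>x' = A x\<close>, \<open>y = C x\<close>, where \<open>A\<close> generates the strongly continuous
  semigroup \<open>T\<close>. All notions below depend on \<open>A\<close> only through the mild solutions, that is,
  through \<open>T\<close>, which is therefore the parameter they carry.\<close>

definition linear_output_system ::
  "('x::real_normed_vector \<times> 'x) set \<Rightarrow> (real \<Rightarrow> 'x \<Rightarrow> 'x) \<Rightarrow> ('x \<Rightarrow> 'y::real_normed_vector) \<Rightarrow> bool" where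
  "linear_output_system A T C \<longleftrightarrow> c0_semigroup T \<and> A = generator T \<and> bounded_linear C"

definition mild_solution :: "(real \<Rightarrow> 'x \<Rightarrow> 'x) \<Rightarrow> real \<Rightarrow> 'x \<Rightarrow> 'x" where
  "mild_solution T t x = T t x"

definition output_traj :: "(real \<Rightarrow> 'x \<Rightarrow> 'x) \<Rightarrow> ('x \<Rightarrow> 'y) \<Rightarrow> real \<Rightarrow> 'x \<Rightarrow> 'y" where
  "output_traj T C t x = C (mild_solution T t x)"

text \<open>The supremum below is a maximum because the outputs of a \<open>linear_output_system\<close> are
  continuous in time.\<close>

definition eOSS_linear_gain ::
  "(real \<Rightarrow> 'x::real_normed_vector \<Rightarrow> 'x) \<Rightarrow> ('x \<Rightarrow> 'y::real_normed_vector) \<Rightarrow> bool" where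
  "eOSS_linear_gain T C \<longleftrightarrow>
     (\<exists>M>0. \<exists>\<mu>>0. \<exists>\<gamma>\<in>class_K. linear_gain \<gamma> \<and>
        (\<forall>x. \<forall>t\<ge>0. norm (mild_solution T t x)
           \<le> M * exp (- \<mu> * t) * norm x + \<gamma> (SUP s\<in>{0..t}. norm (output_traj T C s x))))"

section \<open>Lyapunov functions\<close>

definition lie_derivative :: "(real \<Rightarrow> 'x \<Rightarrow> 'x) \<Rightarrow> ('x \<Rightarrow> real) \<Rightarrow> 'x \<Rightarrow> ereal" where
  "lie_derivative T V x =
     Limsup (at_right 0) (\<lambda>\<tau>. ereal ((V (mild_solution T \<tau> x) - V x) / \<tau>))"

definition continuous_along_trajectories :: "(real \<Rightarrow> 'x \<Rightarrow> 'x) \<Rightarrow> ('x \<Rightarrow> real) \<Rightarrow> bool" where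
  "continuous_along_trajectories T V \<longleftrightarrow>
     (\<forall>x. continuous_on {0..} (\<lambda>t. V (mild_solution T t x)))"

definition coercive :: "real \<Rightarrow> ('x::real_normed_vector \<Rightarrow> real) \<Rightarrow> bool" where
  "coercive p V \<longleftrightarrow>
     p > 0 \<and> (\<exists>k1>0. \<exists>k2>0. \<forall>x. k1 * norm x powr p \<le> V x \<and> V x \<le> k2 * norm x powr p)"

definition eOSS_Lyapunov_dissipation ::
  "(real \<Rightarrow> 'x::real_normed_vector \<Rightarrow> 'x) \<Rightarrow> ('x \<Rightarrow> 'y::real_normed_vector) \<Rightarrow> real
     \<Rightarrow> ('x \<Rightarrow> real) \<Rightarrow> bool" where
  "eOSS_Lyapunov_dissipation T C p V \<longleftrightarrow>
     (\<forall>x. V x \<ge> 0) \<and> coercive p V \<and> continuous_along_trajectories T V \<and>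
     (\<exists>\<alpha>>0. \<exists>\<sigma>\<in>class_K_inf. \<forall>x.
        lie_derivative T V x \<le> ereal (- \<alpha> * norm x powr p + \<sigma> (norm (C x))))"

definition implication_decay ::
  "(real \<Rightarrow> 'x::real_normed_vector \<Rightarrow> 'x) \<Rightarrow> ('x \<Rightarrow> 'y::real_normed_vector) \<Rightarrow> real
     \<Rightarrow> ('x \<Rightarrow> real) \<Rightarrow> (real \<Rightarrow> real) \<Rightarrow> bool" where
  "implication_decay T C p V \<gamma> \<longleftrightarrow>
     (\<exists>\<alpha>>0. \<forall>x. norm x \<ge> \<gamma> (norm (C x)) \<longrightarrow> lie_derivative T V x \<le> ereal (- \<alpha> * norm x powr p))"

definition eOSS_Lyapunov_implication ::
  "(real \<Rightarrow> 'x::real_normed_vector \<Rightarrow> 'x) \<Rightarrow> ('x \<Rightarrow> 'y::real_normed_vector) \<Rightarrow> real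
     \<Rightarrow> ('x \<Rightarrow> real) \<Rightarrow> bool" where
  "eOSS_Lyapunov_implication T C p V \<longleftrightarrow>
     (\<forall>x. V x \<ge> 0) \<and> coercive p V \<and> continuous_along_trajectories T V \<and>
     (\<exists>\<gamma>\<in>class_K_inf. implication_decay T C p V \<gamma>)"

definition linear_Lyapunov_gain ::
  "(real \<Rightarrow> 'x::real_normed_vector \<Rightarrow> 'x) \<Rightarrow> ('x \<Rightarrow> 'y::real_normed_vector) \<Rightarrow> real
     \<Rightarrow> ('x \<Rightarrow> real) \<Rightarrow> bool" where
  "linear_Lyapunov_gain T C p V \<longleftrightarrow>
     (\<exists>\<gamma>\<in>class_K_inf. linear_gain \<gamma> \<and> implication_decay T C p V \<gamma>)"

section \<open>The space of continuous periodic functions\<close>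

typedef c2pi = "{f :: real \<Rightarrow> complex. continuous_on UNIV f \<and> (\<forall>s. f (s + 2 * pi) = f s)}"
  morphisms apply_c2pi Abs_c2pi
  by (intro exI[of _ "\<lambda>_. 0"]) auto

setup_lifting type_definition_c2pi

lemma continuous_on_apply_c2pi: "continuous_on S (apply_c2pi x)"
  using apply_c2pi[of x] by (auto intro: continuous_on_subset)

lemma apply_c2pi_range: "\<exists>r\<in>{0..2 * pi}. apply_c2pi x s = apply_c2pi x r"
proof -
  interpret periodic_fun_simple "apply_c2pi x" "2 * pi"
    using apply_c2pi[of x] by unfold_locales auto
  define r where "r = s - of_int \<lfloor>s / (2 * pi)\<rfloor> * (2 * pi)"
  have "of_int \<lfloor>s / (2 * pi)\<rfloor> * (2 * pi) \<le> s / (2 * pi) * (2 * pi)"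
    by (intro mult_right_mono) auto
  moreover have "s / (2 * pi) * (2 * pi) \<le> (of_int \<lfloor>s / (2 * pi)\<rfloor> + 1) * (2 * pi)"
    by (intro mult_right_mono) (linarith, simp)
  ultimately have "r \<in> {0..2 * pi}"
    by (auto simp: r_def algebra_simps)
  moreover have "apply_c2pi x s = apply_c2pi x r"
    using plus_of_int[of r "\<lfloor>s / (2 * pi)\<rfloor>"] by (simp add: r_def)
  ultimately show ?thesis by blast
qed

lemma apply_c2pi_max: "\<exists>r. \<forall>s. norm (apply_c2pi x s) \<le> norm (apply_c2pi x r)"
proof -
  have "\<exists>r\<in>{0..2 * pi}. \<forall>s\<in>{0..2 * pi}. norm (apply_c2pi x s) \<le> norm (apply_c2pi x r)"
    by (intro continuous_attains_sup continuous_on_norm continuous_on_apply_c2pi) auto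
  then show ?thesis
    by (metis apply_c2pi_range)
qed

instantiation c2pi :: real_vector
begin

lift_definition zero_c2pi :: c2pi is "\<lambda>_. 0" by auto
lift_definition uminus_c2pi :: "c2pi \<Rightarrow> c2pi" is "\<lambda>f s. - f s" by (auto intro: continuous_intros)
lift_definition plus_c2pi :: "c2pi \<Rightarrow> c2pi \<Rightarrow> c2pi" is "\<lambda>f g s. f s + g s"
  by (auto intro: continuous_intros)
lift_definition minus_c2pi :: "c2pi \<Rightarrow> c2pi \<Rightarrow> c2pi" is "\<lambda>f g s. f s - g s"
  by (auto intro: continuous_intros)
lift_definition scaleR_c2pi :: "real \<Rightarrow> c2pi \<Rightarrow> c2pi" is "\<lambda>c f s. c *\<^sub>R f s"
  by (auto intro: continuous_intros)

instance
  by standard (transfer; simp add: fun_eq_iff algebra_simps)+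

end

lemmas apply_c2pi_simps [simp] =
  zero_c2pi.rep_eq uminus_c2pi.rep_eq plus_c2pi.rep_eq minus_c2pi.rep_eq scaleR_c2pi.rep_eq

instantiation c2pi :: real_normed_vector
begin

definition norm_c2pi :: "c2pi \<Rightarrow> real" where
  "norm_c2pi x = (SUP s. norm (apply_c2pi x s))"
definition sgn_c2pi :: "c2pi \<Rightarrow> c2pi" where
  "sgn_c2pi x = x /\<^sub>R norm x"
definition dist_c2pi :: "c2pi \<Rightarrow> c2pi \<Rightarrow> real" where
  "dist_c2pi x y = norm (x - y)"
definition uniformity_c2pi :: "(c2pi \<times> c2pi) filter" where
  "uniformity_c2pi = (INF e\<in>{0 <..}. principal {(x, y). dist x y < e})"
definition open_c2pi :: "c2pi set \<Rightarrow> bool" where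
  "open_c2pi S = (\<forall>x\<in>S. \<forall>\<^sub>F (x', y) in uniformity. x' = x \<longrightarrow> y \<in> S)"

lemma norm_apply_c2pi_le: "norm (apply_c2pi x s) \<le> norm x"
proof -
  have "bdd_above (range (\<lambda>s. norm (apply_c2pi x s)))"
    using apply_c2pi_max[of x] by (auto simp: bdd_above_def)
  then show ?thesis
    unfolding norm_c2pi_def by (intro cSUP_upper) auto
qed

lemma norm_c2pi_le: "(\<And>s. norm (apply_c2pi x s) \<le> b) \<Longrightarrow> norm x \<le> b"
  unfolding norm_c2pi_def by (intro cSUP_least) auto

lemma norm_c2pi_attained: "\<exists>s. norm x = norm (apply_c2pi x s)"
proof -
  obtain r where "\<And>s. norm (apply_c2pi x s) \<le> norm (apply_c2pi x r)"
    using apply_c2pi_max by blast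
  then have "norm x = norm (apply_c2pi x r)"
    by (intro order_antisym norm_c2pi_le norm_apply_c2pi_le)
  then show ?thesis by blast
qed

instance
proof
  fix x y :: c2pi and c :: real
  show "norm x = 0 \<longleftrightarrow> x = 0"
  proof
    assume "norm x = 0"
    then have "apply_c2pi x s = 0" for s
      using norm_apply_c2pi_le[of x s] by simp
    then show "x = 0"
      by (intro apply_c2pi_inject[THEN iffD1]) auto
  next
    assume "x = 0"
    then show "norm x = 0" by (simp add: norm_c2pi_def)
  qed
  show "norm (x + y) \<le> norm x + norm y"
    by (intro norm_c2pi_le)
      (auto intro!: norm_triangle_le add_mono norm_apply_c2pi_le)
  obtain s where s: "norm x = norm (apply_c2pi x s)"
    using norm_c2pi_attained by blast
  show "norm (c *\<^sub>R x) = \<bar>c\<bar> * norm x"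
  proof (rule order_antisym)
    show "norm (c *\<^sub>R x) \<le> \<bar>c\<bar> * norm x"
      by (intro norm_c2pi_le) (auto intro!: mult_left_mono norm_apply_c2pi_le)
    show "\<bar>c\<bar> * norm x \<le> norm (c *\<^sub>R x)"
      using norm_apply_c2pi_le[of "c *\<^sub>R x" s] s by simp
  qed
qed (simp_all only: sgn_c2pi_def dist_c2pi_def uniformity_c2pi_def open_c2pi_def)

end

section \<open>The translation group with point evaluation as output\<close>

lift_definition left_translation :: "real \<Rightarrow> c2pi \<Rightarrow> c2pi" is "\<lambda>t f s. f (s + t)"
proof (intro conjI allI)
  fix t s and f :: "real \<Rightarrow> complex"
  assume f: "continuous_on UNIV f \<and> (\<forall>s. f (s + 2 * pi) = f s)"
  show "continuous_on UNIV (\<lambda>s. f (s + t))"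
    by (rule continuous_on_compose2[of UNIV f]) (use f in \<open>auto intro: continuous_intros\<close>)
  show "f (s + 2 * pi + t) = f (s + t)"
    using spec[OF conjunct2[OF f], of "s + t"] by (simp add: ac_simps)
qed

definition eval_at_0 :: "c2pi \<Rightarrow> complex" where
  "eval_at_0 x = apply_c2pi x 0"

lemma norm_left_translation [simp]: "norm (left_translation t x) = norm x"
proof (rule order_antisym)
  show "norm (left_translation t x) \<le> norm x"
    by (intro norm_c2pi_le) (simp add: left_translation.rep_eq norm_apply_c2pi_le)
  have "norm (apply_c2pi x s) \<le> norm (left_translation t x)" for s
    using norm_apply_c2pi_le[of "left_translation t x" "s - t"] by (simp add: left_translation.rep_eq)
  then show "norm x \<le> norm (left_translation t x)"
    by (rule norm_c2pi_le)
qed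

lemma left_translation_tendsto: "((\<lambda>t. left_translation t x) \<longlongrightarrow> x) (at_right 0)"
proof (rule tendstoI)
  fix e :: real assume "e > 0"
  have "uniformly_continuous_on {0..2 * pi + 1} (apply_c2pi x)"
    by (intro compact_uniformly_continuous continuous_on_apply_c2pi) auto
  then obtain d where d: "d > 0"
    and dd: "\<And>s s'. s \<in> {0..2 * pi + 1} \<Longrightarrow> s' \<in> {0..2 * pi + 1} \<Longrightarrow> dist s' s < d \<Longrightarrow>
      dist (apply_c2pi x s') (apply_c2pi x s) < e / 2"
    using half_gt_zero[OF \<open>e > 0\<close>] unfolding uniformly_continuous_on_def by blast
  have "dist (left_translation t x) x < e" if t: "0 < t" "t < min d 1" for t
  proof -
    have "norm (apply_c2pi (left_translation t x - x) s) \<le> e / 2" for s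
    proof -
      obtain r where r: "r \<in> {0..2 * pi}"
        "apply_c2pi (left_translation t x - x) s = apply_c2pi (left_translation t x - x) r"
        using apply_c2pi_range by blast
      have "dist (apply_c2pi x (r + t)) (apply_c2pi x r) < e / 2"
        using r t by (intro dd) (auto simp: dist_norm)
      then show ?thesis
        unfolding r(2) by (simp add: left_translation.rep_eq dist_norm)
    qed
    then have "norm (left_translation t x - x) \<le> e / 2"
      by (rule norm_c2pi_le)
    then show ?thesis
      using \<open>e > 0\<close> by (simp add: dist_norm)
  qed
  then show "\<forall>\<^sub>F t in at_right 0. dist (left_translation t x) x < e"
    using d by (intro eventually_at_rightI[of 0 "min d 1"]) auto
qed

lemma linear_output_system_left_translation:
  "linear_output_system (generator left_translation) left_translation eval_at_0"
proof -
  have "bounded_linear (left_translation t)" for t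
  proof (rule bounded_linear_intro[where K = 1])
    fix x y c
    show "left_translation t (x + y) = left_translation t x + left_translation t y"
      by transfer simp
    show "left_translation t (c *\<^sub>R x) = c *\<^sub>R left_translation t x"
      by transfer simp
  qed simp
  moreover have "left_translation 0 x = x" "left_translation (s + t) x = left_translation s (left_translation t x)"
    for s t x
    by (transfer; simp add: ac_simps)+
  moreover have "bounded_linear eval_at_0"
    by (rule bounded_linear_intro[where K = 1]) (simp_all add: eval_at_0_def norm_apply_c2pi_le)
  ultimately show ?thesis
    unfolding linear_output_system_def c0_semigroup_def using left_translation_tendsto by blast
qed

end

theory Submission
  imports Defs
begin

text \<open>
  The translation group is isometric and \<open>2\<pi>\<close>-periodic, and the output over one period runs
  through all the values of the initial state. Everything follows from these two facts.

  For the Lyapunov function in implication form, take the maximum of \<open>e\<^sup>s |x(s)|\<close> over one period.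
  A translation by a small \<open>\<tau>\<close> multiplies the weight of every value by \<open>exp (- \<tau>)\<close>, except for
  the values near \<open>0\<close>, which leave the window on the left and come back on the right with nearly
  the largest weight \<open>exp (2 * pi)\<close>. If \<open>|x(0)|\<close> is small compared with \<open>\<parallel>x\<parallel>\<close>, these values stay
  below the maximum, and the function decays (\<open>weighted_sup_decay\<close>).

  The estimate for eOSS holds with the output alone as soon as a whole period has been observed,
  because the largest output then equals the norm of the state; before that time, a constant
  \<open>M\<close> that offsets the exponential over one period suffices.

  A dissipation inequality, on the other hand, can be integrated along a trajectory
  (\<open>semigroup_increment_le\<close>). Over a period, \<open>V\<close> returns to its initial value, while the norm of
  the state remains constant. Hence the integral of \<open>\<sigma>(|x(s)|)\<close> over a period would be at least
  \<open>2\<pi> \<rho>(\<parallel>x\<parallel>)\<close>. A state of norm \<open>1\<close> that vanishes outside a short interval violates this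
  (\<open>no_dissipation_inequality\<close>). The dissipation form of a coercive eOSS Lyapunov function is the
  special case \<open>\<rho>(r) = \<alpha> r\<^sup>p\<close>.
\<close>

section \<open>Dini derivatives\<close>

text \<open>Otherwise, for some slope \<open>d > c\<close>, the function ends above the line of slope \<open>d\<close> through its
  initial point. At the last time at which it is not above that line, it leaves the line upwards,
  although its upper right derivative is less than \<open>d\<close>.\<close>

lemma Dini_increment_le:
  fixes f :: "real \<Rightarrow> real"
  assumes "a \<le> b" and cont: "continuous_on {a..b} f"
    and Dini: "\<And>t. a \<le> t \<Longrightarrow> t < b \<Longrightarrow>
      Limsup (at_right 0) (\<lambda>\<tau>. ereal ((f (t + \<tau>) - f t) / \<tau>)) \<le> ereal c"
  shows "f b - f a \<le> c * (b - a)"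
proof (rule ccontr)
  assume "\<not> ?thesis"
  then have neg: "c * (b - a) < f b - f a" by simp
  then have "a < b"
    using \<open>a \<le> b\<close> by (cases "a = b") auto
  then have "c < (f b - f a) / (b - a)"
    using neg by (simp add: field_simps)
  then obtain d where d: "c < d" "d < (f b - f a) / (b - a)"
    using dense by blast
  define h where "h t = f t - f a - d * (t - a)" for t
  have hb: "h b > 0"
    using d(2) \<open>a < b\<close> by (simp add: h_def field_simps)
  have h_cont: "continuous_on {a..b} h"
    unfolding h_def by (intro continuous_intros cont)
  let ?S = "{t \<in> {a..b}. h t \<le> 0}"
  have "?S = {a..b} \<inter> h -` {..0}"
    by auto
  then have "closed ?S"
    using continuous_closed_preimage[OF h_cont closed_atLeastAtMost closed_atMost] by metis
  moreover have "bounded ?S"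
    by (rule bounded_subset[OF bounded_closed_interval[of a b]]) auto
  ultimately have "compact ?S"
    by (simp only: compact_eq_bounded_closed)
  moreover have "a \<in> ?S"
    using \<open>a \<le> b\<close> by (simp add: h_def)
  ultimately obtain m where m: "m \<in> ?S" and m_max: "\<And>t. t \<in> ?S \<Longrightarrow> t \<le> m"
    using compact_attains_sup[of ?S] by blast
  have "m \<le> b" "h m \<le> 0"
    using m by auto
  then have "m < b"
    using hb by (metis less_le not_le)
  have "a \<le> m"
    using m by simp
  then have "Limsup (at_right 0) (\<lambda>\<tau>. ereal ((f (m + \<tau>) - f m) / \<tau>)) \<le> ereal c"
    using \<open>m < b\<close> by (rule Dini)
  also have "ereal c < ereal d"
    using d(1) by simp
  finally have "\<forall>\<^sub>F \<tau> in at_right 0. ereal ((f (m + \<tau>) - f m) / \<tau>) < ereal d"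
    by (rule Limsup_lessD)
  then have "\<forall>\<^sub>F \<tau> in at_right 0. (f (m + \<tau>) - f m) / \<tau> < d"
    by simp
  moreover have "\<forall>\<^sub>F \<tau> in at_right 0. 0 < \<tau> \<and> \<tau> < b - m"
    using \<open>m < b\<close> by (intro eventually_at_rightI[of 0 "b - m"]) auto
  ultimately have "\<forall>\<^sub>F \<tau> in at_right 0. (f (m + \<tau>) - f m) / \<tau> < d \<and> 0 < \<tau> \<and> \<tau> < b - m"
    by eventually_elim simp
  then obtain \<tau> where \<tau>: "(f (m + \<tau>) - f m) / \<tau> < d" "0 < \<tau>" "\<tau> < b - m"
    using eventually_happens'[OF trivial_limit_at_right_real] by blast
  have "f (m + \<tau>) - f m < d * \<tau>"
    using \<tau>(1,2) by (simp add: field_simps)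
  then have "h (m + \<tau>) \<le> 0"
    using m by (simp add: h_def algebra_simps)
  then have "m + \<tau> \<in> ?S"
    using m \<tau> by simp
  then show False
    using m_max[of "m + \<tau>"] \<tau>(2) by simp
qed

text \<open>By the semigroup law, the Lie derivative at a later point of a trajectory is the upper right
  derivative of \<open>V\<close> along that trajectory.\<close>

lemma semigroup_increment_le:
  assumes T: "c0_semigroup T" and V: "continuous_along_trajectories T V"
    and "0 \<le> a" "a \<le> b"
    and decay: "\<And>t. a \<le> t \<Longrightarrow> t < b \<Longrightarrow> lie_derivative T V (T t x) \<le> ereal c"
  shows "V (T b x) - V (T a x) \<le> c * (b - a)"
proof (rule Dini_increment_le[where f = "\<lambda>t. V (T t x)"])
  show "continuous_on {a..b} (\<lambda>t. V (T t x))"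
    using V \<open>0 \<le> a\<close> unfolding continuous_along_trajectories_def mild_solution_def
    by (auto intro: continuous_on_subset)
  fix t assume t: "a \<le> t" "t < b"
  have "\<forall>\<^sub>F \<tau> in at_right 0. ereal ((V (T \<tau> (T t x)) - V (T t x)) / \<tau>)
      = ereal ((V (T (t + \<tau>) x) - V (T t x)) / \<tau>)"
  proof (rule eventually_at_rightI[of 0 1])
    fix \<tau> :: real assume "\<tau> \<in> {0<..<1}"
    then have "0 \<le> \<tau>" "0 \<le> t"
      using t \<open>0 \<le> a\<close> by auto
    then have "T (\<tau> + t) x = T \<tau> (T t x)"
      using T unfolding c0_semigroup_def by blast
    then show "ereal ((V (T \<tau> (T t x)) - V (T t x)) / \<tau>)
        = ereal ((V (T (t + \<tau>) x) - V (T t x)) / \<tau>)"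
      unfolding add.commute[of t \<tau>] by simp
  qed simp
  then have eq: "lie_derivative T V (T t x)
      = Limsup (at_right 0) (\<lambda>\<tau>. ereal ((V (T (t + \<tau>) x) - V (T t x)) / \<tau>))"
    unfolding lie_derivative_def mild_solution_def by (rule Limsup_eq)
  show "Limsup (at_right 0) (\<lambda>\<tau>. ereal ((V (T (t + \<tau>) x) - V (T t x)) / \<tau>)) \<le> ereal c"
    using decay[OF t] by (simp only: eq)
qed (rule \<open>a \<le> b\<close>)

section \<open>The translation group\<close>

lemma c0_semigroup_left_translation: "c0_semigroup left_translation"
  using linear_output_system_left_translation by (simp add: linear_output_system_def)

lemma left_translation_add:
  "left_translation (s + t) x = left_translation s (left_translation t x)"
  by transfer (simp add: ac_simps)

lemma left_translation_zero [simp]: "left_translation 0 x = x"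
  by transfer simp

lemma left_translation_diff:
  "left_translation t (x - y) = left_translation t x - left_translation t y"
  by transfer simp

lemma apply_c2pi_periodic [simp]: "apply_c2pi x (s + 2 * pi) = apply_c2pi x s"
  using apply_c2pi[of x] by simp

lemma left_translation_period [simp]: "left_translation (2 * pi) x = x"
  by (rule apply_c2pi_inject[THEN iffD1]) (simp add: fun_eq_iff left_translation.rep_eq)

lemma eval_at_0_left_translation [simp]: "eval_at_0 (left_translation t x) = apply_c2pi x t"
  by (simp add: eval_at_0_def left_translation.rep_eq)

lemma norm_c2pi_attained_on_period: "\<exists>s\<in>{0..2 * pi}. norm x = norm (apply_c2pi x s)"
  using norm_c2pi_attained[of x] apply_c2pi_range[of x] by metis

text \<open>Since translations are isometries, the distance of two points of an orbit depends only on
  the time between them; right continuity at \<open>0\<close> is therefore enough.\<close>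

lemma continuous_on_left_translation: "continuous_on S (\<lambda>t. left_translation t x)"
proof -
  have "continuous_on UNIV (\<lambda>t. left_translation t x)"
    unfolding continuous_on_iff
  proof (intro ballI allI impI)
    fix t e :: real assume "e > 0"
    then have "\<forall>\<^sub>F \<tau> in at_right 0. dist (left_translation \<tau> x) x < e"
      using left_translation_tendsto[of x] by (simp add: tendsto_iff)
    then obtain d where d: "d > 0" "\<And>\<tau>. 0 < \<tau> \<Longrightarrow> \<tau> < d \<Longrightarrow> dist (left_translation \<tau> x) x < e"
      unfolding eventually_at_right_field by auto
    have shift: "dist (left_translation (s + \<tau>) x) (left_translation s x)
        = dist (left_translation \<tau> x) x" for s \<tau>
      by (simp add: left_translation_add dist_norm flip: left_translation_diff)
    have "dist (left_translation t' x) (left_translation t x) < e" if "dist t' t < d" for t'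
    proof (cases t' t rule: linorder_cases)
      case less
      then show ?thesis
        using shift[of t' "t - t'"] d(2)[of "t - t'"] that by (simp add: dist_commute dist_norm)
    next
      case equal
      then show ?thesis using \<open>e > 0\<close> by simp
    next
      case greater
      then show ?thesis
        using shift[of t "t' - t"] d(2)[of "t' - t"] that by (simp add: dist_norm)
    qed
    then show "\<exists>d>0. \<forall>t'\<in>UNIV. dist t' t < d \<longrightarrow>
        dist (left_translation t' x) (left_translation t x) < e"
      using d(1) by blast
  qed
  then show ?thesis by (rule continuous_on_subset) simp
qed

section \<open>A Lyapunov function in implication form\<close>

definition weighted_sup :: "c2pi \<Rightarrow> real" where
  "weighted_sup x = (SUP s\<in>{0..2 * pi}. exp s * norm (apply_c2pi x s))"

lemma exp_mult_norm_apply_le: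
  "s \<le> 2 * pi \<Longrightarrow> exp s * norm (apply_c2pi x s) \<le> exp (2 * pi) * norm x"
  by (intro mult_mono norm_apply_c2pi_le) auto

lemma weighted_sup_upper:
  assumes "s \<in> {0..2 * pi}"
  shows "exp s * norm (apply_c2pi x s) \<le> weighted_sup x"
proof -
  have "bdd_above ((\<lambda>s. exp s * norm (apply_c2pi x s)) ` {0..2 * pi})"
    by (rule bdd_aboveI[of _ "exp (2 * pi) * norm x"]) (auto intro!: exp_mult_norm_apply_le)
  then show ?thesis
    unfolding weighted_sup_def using assms by (rule cSUP_upper2) auto
qed

lemma weighted_sup_least:
  "(\<And>s. s \<in> {0..2 * pi} \<Longrightarrow> exp s * norm (apply_c2pi x s) \<le> b) \<Longrightarrow> weighted_sup x \<le> b"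
  unfolding weighted_sup_def by (intro cSUP_least) auto

lemma norm_le_weighted_sup: "norm x \<le> weighted_sup x"
proof -
  obtain s where s: "s \<in> {0..2 * pi}" "norm x = norm (apply_c2pi x s)"
    using norm_c2pi_attained_on_period by blast
  have "1 * norm (apply_c2pi x s) \<le> exp s * norm (apply_c2pi x s)"
    using s(1) by (intro mult_right_mono) auto
  then show ?thesis
    using weighted_sup_upper[OF s(1), of x] s(2) by simp
qed

lemma weighted_sup_le_norm: "weighted_sup x \<le> exp (2 * pi) * norm x"
  by (intro weighted_sup_least exp_mult_norm_apply_le) auto

lemma coercive_weighted_sup: "coercive 1 weighted_sup"
proof -
  have "1 * norm x powr 1 \<le> weighted_sup x \<and> weighted_sup x \<le> exp (2 * pi) * norm x powr 1" for x
    using norm_le_weighted_sup[of x] weighted_sup_le_norm[of x] by simp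
  then show ?thesis
    unfolding coercive_def by (intro conjI exI[of _ 1] exI[of _ "exp (2 * pi)"]) auto
qed

lemma weighted_sup_le_add: "weighted_sup x \<le> weighted_sup y + exp (2 * pi) * norm (x - y)"
proof (rule weighted_sup_least)
  fix s assume s: "s \<in> {0..2 * pi}"
  have "exp s * norm (apply_c2pi x s)
      \<le> exp s * (norm (apply_c2pi y s) + norm (apply_c2pi (x - y) s))"
    by (intro mult_left_mono) (auto simp: norm_triangle_sub)
  then show "exp s * norm (apply_c2pi x s) \<le> weighted_sup y + exp (2 * pi) * norm (x - y)"
    using weighted_sup_upper[OF s, of y] exp_mult_norm_apply_le[of s "x - y"] s
    by (simp add: distrib_left)
qed

lemma continuous_along_weighted_sup: "continuous_along_trajectories left_translation weighted_sup"
proof -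
  have "\<bar>weighted_sup x - weighted_sup y\<bar> \<le> exp (2 * pi) * norm (x - y)" for x y
    using weighted_sup_le_add[of x y] weighted_sup_le_add[of y x] by (simp add: norm_minus_commute)
  then have "(exp (2 * pi))-lipschitz_on UNIV weighted_sup"
    by (intro lipschitz_onI) (auto simp: dist_norm)
  then have "continuous_on UNIV weighted_sup"
    by (rule lipschitz_on_continuous_on)
  then show ?thesis
    unfolding continuous_along_trajectories_def mild_solution_def
    by (auto intro: continuous_on_compose2 continuous_on_left_translation)
qed

text \<open>The threshold \<open>exp (2 * pi) * norm (apply_c2pi x 0)\<close> is the weighted size with which
  the value at \<open>0\<close> reappears at the right end of the window.\<close>

lemma weighted_sup_decay:
  assumes small: "exp (2 * pi) * norm (apply_c2pi x 0) < weighted_sup x"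
  shows "\<forall>\<^sub>F \<tau> in at_right 0.
    weighted_sup (left_translation \<tau> x) \<le> exp (- \<tau>) * weighted_sup x"
proof -
  have "((\<lambda>r. exp (2 * pi + r) * norm (apply_c2pi x r)) \<longlongrightarrow> exp (2 * pi + 0) * norm (apply_c2pi x 0))
      (at_right 0)"
    using continuous_on_apply_c2pi[of UNIV x]
    by (intro tendsto_intros) (auto simp: continuous_on_def intro: tendsto_within_subset)
  then have "\<forall>\<^sub>F r in at_right 0. exp (2 * pi + r) * norm (apply_c2pi x r) < weighted_sup x"
    by (rule order_tendstoD) (use small in simp)
  then obtain d where d: "d > 0"
    and wrap: "\<And>r. 0 < r \<Longrightarrow> r < d \<Longrightarrow> exp (2 * pi + r) * norm (apply_c2pi x r) < weighted_sup x"
    unfolding eventually_at_right_field by auto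
  have "weighted_sup (left_translation \<tau> x) \<le> exp (- \<tau>) * weighted_sup x"
    if \<tau>: "0 < \<tau>" "\<tau> < d" for \<tau>
  proof (rule weighted_sup_least)
    fix s assume s: "s \<in> {0..2 * pi}"
    have "exp (s + \<tau>) * norm (apply_c2pi x (s + \<tau>)) \<le> weighted_sup x"
    proof (cases "s + \<tau> \<le> 2 * pi")
      case True
      then show ?thesis
        using s \<tau> by (intro weighted_sup_upper) auto
    next
      case False
      define r where "r = s + \<tau> - 2 * pi"
      have "0 < r" "r < d"
        using False s \<tau> by (auto simp: r_def)
      moreover have "s + \<tau> = r + 2 * pi"
        by (simp add: r_def)
      ultimately show ?thesis
        using wrap[of r] by (simp add: add.commute)
    qed
    then have "exp (- \<tau>) * (exp (s + \<tau>) * norm (apply_c2pi x (s + \<tau>)))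
        \<le> exp (- \<tau>) * weighted_sup x"
      by (intro mult_left_mono) auto
    then show "exp s * norm (apply_c2pi (left_translation \<tau> x) s) \<le> exp (- \<tau>) * weighted_sup x"
      by (simp add: left_translation.rep_eq flip: mult.assoc exp_add)
  qed
  then show ?thesis
    using d by (intro eventually_at_rightI[of 0 d]) auto
qed

lemma Limsup_le_of_exp_decay:
  fixes f :: "real \<Rightarrow> real"
  assumes "\<forall>\<^sub>F \<tau> in at_right 0. f \<tau> \<le> exp (- \<tau>) * c"
  shows "Limsup (at_right 0) (\<lambda>\<tau>. ereal ((f \<tau> - c) / \<tau>)) \<le> ereal (- c)"
proof -
  have "((\<lambda>\<tau>. exp (- \<tau>) * c) has_real_derivative - c) (at 0)"
    by (auto intro!: derivative_eq_intros)
  then have "((\<lambda>\<tau>. (exp (- \<tau>) * c - c) / \<tau>) \<longlongrightarrow> - c) (at 0)"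
    by (simp add: has_field_derivative_iff)
  then have "((\<lambda>\<tau>. (exp (- \<tau>) * c - c) / \<tau>) \<longlongrightarrow> - c) (at_right 0)"
    by (rule tendsto_within_subset) simp
  then have "((\<lambda>\<tau>. ereal ((exp (- \<tau>) * c - c) / \<tau>)) \<longlongrightarrow> ereal (- c)) (at_right 0)"
    by (rule tendsto_ereal)
  then have lim: "Limsup (at_right 0) (\<lambda>\<tau>. ereal ((exp (- \<tau>) * c - c) / \<tau>)) = ereal (- c)"
    by (intro lim_imp_Limsup) auto
  have "\<forall>\<^sub>F \<tau> in at_right (0::real). \<tau> > 0"
    by (rule eventually_at_right_less)
  with assms have "\<forall>\<^sub>F \<tau> in at_right 0. ereal ((f \<tau> - c) / \<tau>) \<le> ereal ((exp (- \<tau>) * c - c) / \<tau>)"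
    by eventually_elim (simp add: divide_right_mono)
  from Limsup_mono[OF this] show ?thesis
    by (simp add: lim)
qed

text \<open>The factor \<open>2\<close> in the gain makes the inequality required by \<open>weighted_sup_decay\<close> strict
  for every nonzero state.\<close>

lemma implication_decay_weighted_sup:
  "implication_decay left_translation eval_at_0 1 weighted_sup (\<lambda>r. 2 * exp (2 * pi) * r)"
  unfolding implication_decay_def
proof (intro exI[of _ 1] conjI allI impI)
  fix x assume gain: "2 * exp (2 * pi) * norm (eval_at_0 x) \<le> norm x"
  have "\<forall>\<^sub>F \<tau> in at_right 0. weighted_sup (left_translation \<tau> x) \<le> exp (- \<tau>) * weighted_sup x"
  proof (cases "x = 0")
    case True
    have "weighted_sup (left_translation \<tau> 0) \<le> exp (- \<tau>) * weighted_sup 0" for \<tau>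
      using weighted_sup_le_norm[of "left_translation \<tau> 0"] norm_le_weighted_sup[of 0]
      by (auto intro: order_trans)
    then show ?thesis
      using True by simp
  next
    case False
    then have "exp (2 * pi) * norm (apply_c2pi x 0) < norm x"
      using gain zero_less_norm_iff[of x] unfolding eval_at_0_def by linarith
    then show ?thesis
      using norm_le_weighted_sup[of x] by (intro weighted_sup_decay) linarith
  qed
  from Limsup_le_of_exp_decay[OF this]
  have "lie_derivative left_translation weighted_sup x \<le> ereal (- weighted_sup x)"
    by (simp add: lie_derivative_def mild_solution_def)
  then show "lie_derivative left_translation weighted_sup x \<le> ereal (- 1 * norm x powr 1)"
    by (rule order_trans) (use norm_le_weighted_sup[of x] in simp)
qed simp

lemma linear_class_K_inf:
  fixes c :: real
  assumes "c > 0"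
  shows "(\<lambda>r. c * r) \<in> class_K_inf"
proof -
  have "\<not> bdd_above ((\<lambda>r. c * r) ` {0..})"
  proof
    assume "bdd_above ((\<lambda>r. c * r) ` {0..})"
    then obtain m where m: "\<And>r. r \<ge> 0 \<Longrightarrow> c * r \<le> m"
      by (auto simp: bdd_above_def)
    have "c * ((\<bar>m\<bar> + 1) / c) \<le> m"
      using assms by (intro m) auto
    then show False
      using assms by simp
  qed
  then show ?thesis
    using assms unfolding class_K_inf_def class_K_def class_P_def
    by (auto intro!: continuous_intros strict_mono_onI)
qed

lemma implication_Lyapunov_weighted_sup:
  "eOSS_Lyapunov_implication left_translation eval_at_0 1 weighted_sup"
  "linear_Lyapunov_gain left_translation eval_at_0 1 weighted_sup"
proof -
  have \<chi>: "(\<lambda>r. 2 * exp (2 * pi) * r) \<in> class_K_inf"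
    by (rule linear_class_K_inf) simp
  have "weighted_sup x \<ge> 0" for x
    using norm_le_weighted_sup[of x] norm_ge_zero[of x] by linarith
  then show "eOSS_Lyapunov_implication left_translation eval_at_0 1 weighted_sup"
    unfolding eOSS_Lyapunov_implication_def
    using coercive_weighted_sup continuous_along_weighted_sup implication_decay_weighted_sup \<chi>
    by blast
  show "linear_Lyapunov_gain left_translation eval_at_0 1 weighted_sup"
    unfolding linear_Lyapunov_gain_def linear_gain_def
    using implication_decay_weighted_sup \<chi> by blast
qed

section \<open>Output-to-state stability\<close>

lemma eOSS_left_translation: "eOSS_linear_gain left_translation eval_at_0"
proof -
  have bound: "norm x \<le> exp (2 * pi) * exp (- 1 * t) * norm x
      + 1 * (SUP s\<in>{0..t}. norm (apply_c2pi x s))" if "t \<ge> 0" for x t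
  proof -
    have bdd: "bdd_above ((\<lambda>s. norm (apply_c2pi x s)) ` {0..t})"
      by (rule bdd_aboveI[of _ "norm x"]) (auto simp: norm_apply_c2pi_le)
    show ?thesis
    proof (cases "t \<le> 2 * pi")
      case True
      then have "1 * norm x \<le> exp (2 * pi + - 1 * t) * norm x"
        by (intro mult_right_mono) auto
      moreover have "0 \<le> (SUP s\<in>{0..t}. norm (apply_c2pi x s))"
        using that by (intro cSUP_upper2[OF bdd, of 0]) auto
      ultimately show ?thesis
        unfolding exp_add by simp
    next
      case False
      obtain s where s: "s \<in> {0..2 * pi}" "norm x = norm (apply_c2pi x s)"
        using norm_c2pi_attained_on_period by blast
      then have "norm x \<le> (SUP s\<in>{0..t}. norm (apply_c2pi x s))"
        using False by (intro cSUP_upper2[OF bdd, of s]) auto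
      then show ?thesis
        by (simp add: add_increasing)
    qed
  qed
  have "(\<lambda>r::real. 1 * r) \<in> class_K"
    using linear_class_K_inf[of 1] by (simp add: class_K_inf_def)
  moreover have "linear_gain (\<lambda>r. 1 * r)"
    unfolding linear_gain_def by blast
  ultimately show ?thesis
    unfolding eOSS_linear_gain_def output_traj_def mild_solution_def
      norm_left_translation eval_at_0_left_translation
    by (intro exI[of _ "exp (2 * pi)"] exI[of _ 1] bexI[of _ "\<lambda>r. 1 * r"] conjI allI impI bound)
      simp_all
qed

section \<open>Dissipation inequalities\<close>

lemma cos_le_cos_outside:
  assumes "0 < a" "a < pi" "a \<le> u" "u \<le> 2 * pi - a"
  shows "cos u \<le> cos a"
proof (cases "u \<le> pi")
  case True
  then show ?thesis
    using assms by (intro cos_monotone_0_pi_le) auto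
next
  case False
  then have "cos (2 * pi - u) \<le> cos a"
    using assms by (intro cos_monotone_0_pi_le) auto
  then show ?thesis by simp
qed

text \<open>The bump is the positive part of \<open>cos (s - a) - cos a\<close>, scaled to have maximum \<open>1\<close>.\<close>

lemma bump_exists:
  assumes a: "0 < a" "a < pi"
  shows "\<exists>x. norm x = 1 \<and> (\<forall>s\<in>{2 * a..2 * pi}. apply_c2pi x s = 0)"
proof -
  define f where "f s = max 0 ((cos (s - a) - cos a) / (1 - cos a))" for s
  have pos: "0 < 1 - cos a"
    using a cos_monotone_0_pi[of 0 a] by simp
  have "continuous_on UNIV (\<lambda>s. complex_of_real (f s))"
    using pos unfolding f_def by (intro continuous_intros) auto
  moreover have "f (s + 2 * pi) = f s" for s
    using cos_periodic[of "s - a"] by (simp add: f_def algebra_simps)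
  ultimately have x: "apply_c2pi (Abs_c2pi (\<lambda>s. complex_of_real (f s))) = (\<lambda>s. complex_of_real (f s))"
    by (intro Abs_c2pi_inverse) auto
  let ?x = "Abs_c2pi (\<lambda>s. complex_of_real (f s))"
  have "norm ?x \<le> 1"
    using pos by (intro norm_c2pi_le) (simp add: x, simp add: f_def)
  moreover have "1 \<le> norm ?x"
    using norm_apply_c2pi_le[of ?x a] pos unfolding x by (simp add: f_def)
  moreover have "f s = 0" if "s \<in> {2 * a..2 * pi}" for s
    using that pos cos_le_cos_outside[OF a, of "s - a"] by (simp add: f_def field_simps max_def)
  ultimately show ?thesis
    by (intro exI[of _ ?x]) (auto simp: x)
qed

text \<open>For a bump of norm \<open>1\<close>, \<open>V\<close> increases by at most \<open>2 a \<sigma>(1)\<close> while the bump, of width \<open>2 a\<close>,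
  passes the sensor. During the rest of the period the output vanishes and \<open>V\<close> decreases at the
  rate \<open>\<rho>(1)\<close>. For small \<open>a\<close> the decrease prevails, but \<open>V\<close> is periodic.\<close>

lemma no_dissipation_inequality:
  assumes \<rho>: "\<rho> \<in> class_P" and \<sigma>: "\<sigma> \<in> class_K"
    and V: "continuous_along_trajectories left_translation V"
    and diss: "\<And>x. lie_derivative left_translation V x
      \<le> ereal (- \<rho> (norm x) + \<sigma> (norm (eval_at_0 x)))"
  shows False
proof -
  have \<rho>1: "\<rho> 1 > 0" and \<sigma>0: "\<sigma> 0 = 0" and \<sigma>1: "\<sigma> 1 > 0" and \<sigma>_mono: "strict_mono_on {0..} \<sigma>"
    using \<rho> \<sigma> by (auto simp: class_K_def class_P_def)
  (* The balance over a period is negative as soon as a * \<sigma> 1 < pi * \<rho> 1. *)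
  define a where "a = pi * \<rho> 1 / (\<rho> 1 + \<sigma> 1)"
  have a: "0 < a" "a < pi"
    using \<rho>1 \<sigma>1 by (auto simp: a_def field_simps intro: add_pos_pos)
  obtain x where x: "norm x = 1" "\<And>s. s \<in> {2 * a..2 * pi} \<Longrightarrow> apply_c2pi x s = 0"
    using bump_exists[OF a] by blast
  have diss_x: "lie_derivative left_translation V (left_translation t x)
      \<le> ereal (- \<rho> 1 + \<sigma> (norm (apply_c2pi x t)))" for t
    using diss[of "left_translation t x"] x(1) by simp
  have "V (left_translation (2 * a) x) - V (left_translation 0 x) \<le> (- \<rho> 1 + \<sigma> 1) * (2 * a - 0)"
  proof (rule semigroup_increment_le[OF c0_semigroup_left_translation V])
    fix t
    have "norm (apply_c2pi x t) \<le> 1"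
      using norm_apply_c2pi_le[of x t] x(1) by simp
    then have "\<sigma> (norm (apply_c2pi x t)) \<le> \<sigma> 1"
      using strict_mono_on_leD[OF \<sigma>_mono] by simp
    then show "lie_derivative left_translation V (left_translation t x) \<le> ereal (- \<rho> 1 + \<sigma> 1)"
      by (intro order_trans[OF diss_x]) simp
  qed (use a in auto)
  moreover have "V (left_translation (2 * pi) x) - V (left_translation (2 * a) x)
      \<le> - \<rho> 1 * (2 * pi - 2 * a)"
  proof (rule semigroup_increment_le[OF c0_semigroup_left_translation V])
    fix t assume "2 * a \<le> t" "t < 2 * pi"
    then show "lie_derivative left_translation V (left_translation t x) \<le> ereal (- \<rho> 1)"
      using diss_x[of t] x(2)[of t] \<sigma>0 by simp
  qed (use a in auto)
  moreover have "a * (\<rho> 1 + \<sigma> 1) = pi * \<rho> 1"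
    using \<rho>1 \<sigma>1 by (simp add: a_def field_simps)
  moreover have "a * \<rho> 1 > 0"
    using \<rho>1 a by simp
  ultimately show False
    unfolding left_translation_period left_translation_zero by (simp add: algebra_simps)
qed

lemma powr_class_P:
  fixes \<alpha> p :: real
  assumes "\<alpha> > 0" "p > 0"
  shows "(\<lambda>r. \<alpha> * r powr p) \<in> class_P"
proof -
  have "continuous_on {0..} (\<lambda>r. \<alpha> * r powr p)"
    using assms by (intro continuous_intros continuous_on_powr') auto
  then show ?thesis
    using assms by (simp add: class_P_def)
qed

lemma no_dissipation_Lyapunov: "\<not> eOSS_Lyapunov_dissipation left_translation eval_at_0 p V"
proof
  assume "eOSS_Lyapunov_dissipation left_translation eval_at_0 p V"
  then obtain \<alpha> \<sigma> where "p > 0" "\<alpha> > 0" "\<sigma> \<in> class_K_inf"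
    and V: "continuous_along_trajectories left_translation V"
    and diss: "\<And>x. lie_derivative left_translation V x
      \<le> ereal (- (\<alpha> * norm x powr p) + \<sigma> (norm (eval_at_0 x)))"
    unfolding eOSS_Lyapunov_dissipation_def coercive_def by auto
  then show False
    using no_dissipation_inequality[OF powr_class_P _ V diss] by (simp add: class_K_inf_def)
qed

section \<open>Stability without a dissipation form\<close>

theorem proposition5p2:
  fixes A :: "(c2pi \<times> c2pi) set" and T :: "real \<Rightarrow> c2pi \<Rightarrow> c2pi" and C :: "c2pi \<Rightarrow> complex"
  assumes "T = left_translation" and "C = eval_at_0"
    and "A = generator T"
  shows "(\<exists>V. eOSS_Lyapunov_implication T C 1 V \<and> linear_Lyapunov_gain T C 1 V)
    \<and> eOSS_linear_gain T C
    \<and> (\<forall>\<rho>\<in>class_P. \<forall>\<sigma>\<in>class_K_inf.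
         \<not> (\<exists>V :: c2pi \<Rightarrow> real. (\<forall>x. V x \<ge> 0) \<and> continuous_along_trajectories T V \<and>
              (\<forall>x. lie_derivative T V x \<le> ereal (- \<rho> (norm x) + \<sigma> (norm (C x))))))
    \<and> \<not> (\<exists>p V. eOSS_Lyapunov_dissipation T C p V)"
proof -
  have "False" if "\<rho> \<in> class_P" "\<sigma> \<in> class_K_inf" "continuous_along_trajectories left_translation V"
    "\<forall>x. lie_derivative left_translation V x \<le> ereal (- \<rho> (norm x) + \<sigma> (norm (eval_at_0 x)))"
    for \<rho> \<sigma> V
    using that no_dissipation_inequality[of \<rho> \<sigma> V] by (auto simp: class_K_inf_def)
  then show ?thesis
    unfolding assms(1,2)
    using implication_Lyapunov_weighted_sup eOSS_left_translation no_dissipation_Lyapunov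
    by blast
qed

end
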